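(* Let $\lambda_1\le\rho<(\lambda_1+\lambda_2)/2$, and let $\vartheta,\varrho,\varsigma_{\min},\varsigma_{\max},\mathcal X_B$ be as defined in the context. If $\varrho>\rho$, then for every $x\in\mathcal X_B$ and every $v\in T_x\mathcal S^{n-1}$, $$\mu_B\|v\|^2\le\langle v,\nabla^2\mathrm{Rq}_B(x)[v]\rangle\le L_B\|v\|^2,$$ where $$\mu_B=\frac{2\nu_{\min}\lambda_1}{\varsigma_{\max}}\Bigl(1-\frac{\rho}{\varrho}\Bigr)-C_{\mathcal X},\qquad L_B=\frac{2\nu_{\max}\rho}{\varsigma_{\min}}\Bigl(1-\frac{\lambda_1}{\lambda_n}\Bigr)+C_{\mathcal X},$$ $$C_{\mathcal X}=\frac{8\nu_{\max}\rho}{\varsigma_{\min}}\Bigl(\frac{\rho-\lambda_1}{\lambda_1}+\Bigl(\frac{\rho-\lambda_1}{\lambda_1}\Bigr)^{1/2}\cos\vartheta\Bigr),$$ and $\nu_{\min},\nu_{\max}$ are the smallest and largest eigenvalues of $A_B$.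
   Context: $A,M,B\in\mathbb{R}^{n\times n}$ are symmetric positive definite; $0<\lambda_1<\lambda_2\le\dots\le\lambda_n$ are the eigenvalues of the pencil $(A,M)$ and $u_1$ is an eigenvector, $Au_1=\lambda_1Mu_1$. Put $A_B=B^{-1/2}AB^{-1/2}$, $M_B=B^{-1/2}MB^{-1/2}$, $\mathrm{Rq}_B(x)=\frac{x^{\mathsf T}A_Bx}{x^{\mathsf T}M_Bx}$ for $x\neq 0$, and $u_B=B^{1/2}u_1/\|u_1\|_B$, where $\|u\|_B=(u^{\mathsf T}Bu)^{1/2}$ (similarly for other matrices). $\mathcal S^{n-1}$ is the unit sphere of $\mathbb{R}^n$ with the metric induced by the Euclidean inner product, $T_x\mathcal S^{n-1}=\{v:v^{\mathsf T}x=0\}$, and $\nabla^2\mathrm{Rq}_B(x)$ denotes the Riemannian Hessian at $x$ of $\mathrm{Rq}_B$ restricted to $\mathcal S^{n-1}$. $$\mathcal X_B=\{x\in\mathcal S^{n-1}:\ x^{\mathsf T}u_B>0,\ \mathrm{Rq}_B(x)\le\rho\}.$$ Over nonzero vectors $x,v$: $$\vartheta=\inf_{\mathrm{Rq}_B(x)\le\rho}\ \inf_{v^{\mathsf T}x=0}\arccos\frac{|v^{\mathsf T}A_Bx|}{\|v\|_{A_B}\|x\|_{A_B}},\qquad \varrho=\inf_{\mathrm{Rq}_B(x)\le\rho}\ \inf_{v^{\mathsf T}x=0}\mathrm{Rq}_B(v),$$ $$\varsigma_{\max}=\max_{\mathrm{Rq}_B(x)\le\rho}\frac{x^{\mathsf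 T}A_Bx}{x^{\mathsf T}x},\qquad \varsigma_{\min}=\min_{\mathrm{Rq}_B(x)\le\rho}\frac{x^{\mathsf T}A_Bx}{x^{\mathsf T}x}.$$ *)

theory Defs
  imports "HOL-Analysis.Analysis"
begin

section \<open>Symmetric positive definite matrices\<close>

definition spd :: "real ^ 'n ^ 'n \<Rightarrow> bool" where
  "spd A \<longleftrightarrow> transpose A = A \<and> (\<forall>x. x \<noteq> 0 \<longrightarrow> x \<bullet> (A *v x) > 0)"

text \<open>The square root is unique for symmetric positive definite arguments; for other
  arguments the value is unspecified.\<close>

definition spd_sqrt :: "real ^ 'n ^ 'n \<Rightarrow> real ^ 'n ^ 'n" where
  "spd_sqrt B = (THE S. spd S \<and> S ** S = B)"

definition precond :: "real ^ 'n ^ 'n \<Rightarrow> real ^ 'n ^ 'n \<Rightarrow> real ^ 'n ^ 'n" where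
  "precond B A = matrix_inv (spd_sqrt B) ** A ** matrix_inv (spd_sqrt B)"

definition mnorm :: "real ^ 'n ^ 'n \<Rightarrow> real ^ 'n \<Rightarrow> real" where
  "mnorm A x = sqrt (x \<bullet> (A *v x))"

definition Rq :: "real ^ 'n ^ 'n \<Rightarrow> real ^ 'n ^ 'n \<Rightarrow> real ^ 'n \<Rightarrow> real" where
  "Rq A M x = (x \<bullet> (A *v x)) / (x \<bullet> (M *v x))"


section \<open>Eigenvalues\<close>

definition eigenvalues :: "real ^ 'n ^ 'n \<Rightarrow> real set" where
  "eigenvalues A = {c. \<exists>v. v \<noteq> 0 \<and> A *v v = c *\<^sub>R v}"

text \<open>\<open>lam 1 \<le> \<dots> \<le> lam n\<close> are the roots, with multiplicity, of the characteristic
  polynomial \<open>det (A - t M)\<close>, whose leading coefficient is \<open>(-1)^n det M\<close>.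
  Meaningful only for invertible \<open>M\<close>. Indices outside \<open>{1..n}\<close> are irrelevant.\<close>

definition pencil_eigenvalues ::
    "real ^ 'n ^ 'n \<Rightarrow> real ^ 'n ^ 'n \<Rightarrow> (nat \<Rightarrow> real) \<Rightarrow> bool" where
  "pencil_eigenvalues A M lam \<longleftrightarrow>
     mono_on {1..CARD('n)} lam \<and>
     (\<forall>t. det (A - t *\<^sub>R M) = det M * (\<Prod>i = 1..CARD('n). lam i - t))"


section \<open>Riemannian geometry of the unit sphere\<close>

definition tangent_space :: "'a::euclidean_space \<Rightarrow> 'a set" where
  "tangent_space x = {v. v \<bullet> x = 0}"

text \<open>Orthogonal projection onto the tangent space at a unit vector \<open>x\<close>.\<close>

definition tangent_proj :: "'a::euclidean_space \<Rightarrow> 'a \<Rightarrow> 'a" where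
  "tangent_proj x w = w - (x \<bullet> w) *\<^sub>R x"

text \<open>The tangent vector representing the differential at \<open>x\<close> of the restriction of
  \<open>f\<close> to the sphere. Derivatives within the sphere are determined on tangent vectors
  only, and \<open>g\<close> is required to be tangent, so \<open>g\<close> is unique when it exists.\<close>

definition riemannian_grad :: "('a::euclidean_space \<Rightarrow> real) \<Rightarrow> 'a \<Rightarrow> 'a" where
  "riemannian_grad f x =
     (THE g. g \<in> tangent_space x \<and>
             (f has_derivative (\<lambda>h. g \<bullet> h)) (at x within sphere 0 1))"

text \<open>Levi-Civita connection of the induced metric: the tangential part of the derivative
  of the vector field \<open>X\<close> along the sphere. For tangent \<open>v\<close> and differentiable \<open>X\<close> the value does
  not depend on the choice made by \<^const>\<open>frechet_derivative\<close>.\<close>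

definition covariant_deriv ::
    "('a::euclidean_space \<Rightarrow> 'a) \<Rightarrow> 'a \<Rightarrow> 'a \<Rightarrow> 'a" where
  "covariant_deriv X x v =
     tangent_proj x (frechet_derivative X (at x within sphere 0 1) v)"

definition riemannian_hess :: "('a::euclidean_space \<Rightarrow> real) \<Rightarrow> 'a \<Rightarrow> 'a \<Rightarrow> 'a" where
  "riemannian_hess f x v = covariant_deriv (riemannian_grad f) x v"


section \<open>Constants attached to a sublevel set of the Rayleigh quotient\<close>

text \<open>The arguments \<open>A\<close>, \<open>M\<close> are to be instantiated by the preconditioned matrices.\<close>

definition Rq_sublevel :: "real ^ 'n ^ 'n \<Rightarrow> real ^ 'n ^ 'n \<Rightarrow> real \<Rightarrow> (real ^ 'n) set" where
  "Rq_sublevel A M \<rho> = {x. x \<noteq> 0 \<and> Rq A M x \<le> \<rho>}"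

definition min_angle :: "real ^ 'n ^ 'n \<Rightarrow> real ^ 'n ^ 'n \<Rightarrow> real \<Rightarrow> real" where
  "min_angle A M \<rho> =
     (INF x \<in> Rq_sublevel A M \<rho>. INF v \<in> {v. v \<noteq> 0 \<and> v \<bullet> x = 0}.
        arccos (\<bar>v \<bullet> (A *v x)\<bar> / (mnorm A v * mnorm A x)))"

definition min_orth_Rq :: "real ^ 'n ^ 'n \<Rightarrow> real ^ 'n ^ 'n \<Rightarrow> real \<Rightarrow> real" where
  "min_orth_Rq A M \<rho> =
     (INF x \<in> Rq_sublevel A M \<rho>. INF v \<in> {v. v \<noteq> 0 \<and> v \<bullet> x = 0}. Rq A M v)"

text \<open>The quotients below are invariant under scaling of \<open>x\<close>, so by compactness of the
  unit sphere the supremum and infimum are attained whenever the sublevel set is nonempty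
  and \<open>M\<close> is positive definite.\<close>

definition sigma_max :: "real ^ 'n ^ 'n \<Rightarrow> real ^ 'n ^ 'n \<Rightarrow> real \<Rightarrow> real" where
  "sigma_max A M \<rho> = (SUP x \<in> Rq_sublevel A M \<rho>. (x \<bullet> (A *v x)) / (x \<bullet> x))"

definition sigma_min :: "real ^ 'n ^ 'n \<Rightarrow> real ^ 'n ^ 'n \<Rightarrow> real \<Rightarrow> real" where
  "sigma_min A M \<rho> = (INF x \<in> Rq_sublevel A M \<rho>. (x \<bullet> (A *v x)) / (x \<bullet> x))"

end

theory Submission
  imports Defs
begin

text \<open>Write \<open>r = Rq A M x\<close>, \<open>m = x \<bullet> (M *v x)\<close> and \<open>g = v \<bullet> (A x - r M x)\<close>. For a unit vector
  \<open>x\<close> and tangent \<open>v\<close>, differentiating the gradient \<open>(2 / m) (A x - r M x)\<close> gives the quadratic form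
  \<open>(2 / m) (v \<bullet> A v - r (v \<bullet> M v)) - (8 / m\<^sup>2) g (v \<bullet> M x)\<close>. The first term is estimated
  by Rayleigh quotient bounds, since \<open>1 / m = r / (x \<bullet> A x)\<close>. In the second term,
  \<open>r (v \<bullet> M x) = v \<bullet> A x - g\<close>, where \<open>v \<bullet> A x\<close> is controlled by the minimal angle and
  \<open>g\<^sup>2 \<le> (v \<bullet> A v) (x \<bullet> A x) (r - l) / l\<close> for any lower bound \<open>l > 0\<close> of the Rayleigh
  quotient.\<close>

section \<open>Symmetric operators\<close>

text \<open>For small \<open>t\<close> the linear term dominates, so a nonzero \<open>p\<close>
  would make the expression negative on one side of 0. This serves as the first-order optimality
  condition for minimizers.\<close>

lemma quadratic_nonneg_imp_linear_zero:
  fixes p k :: real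
  assumes "\<And>t. 0 \<le> 2 * t * p + t\<^sup>2 * k"
  shows "p = 0"
proof (rule ccontr)
  assume "p \<noteq> 0"
  have k: "k \<ge> 0" using assms[of 1] assms[of "-1"] by simp
  \<comment> \<open>The vertex of the parabola is at \<open>- p / k\<close>; the denominator
    \<open>k + 1\<close> also covers \<open>k = 0\<close> and still gives a negative value.\<close>
  have "2 * (- p / (k+1)) * p + (- p / (k+1))\<^sup>2 * k = - (p\<^sup>2 * (k + 2)) / (k+1)\<^sup>2"
    using k by (simp add: divide_simps power2_eq_square) (simp add: algebra_simps)
  moreover have "p\<^sup>2 * (k + 2) / (k+1)\<^sup>2 > 0"
    using k \<open>p \<noteq> 0\<close> by simp
  ultimately show False using assms[of "- p / (k+1)"] by simp
qed

text \<open>The quotient is invariant under scaling, so it attains its minimum on the compact unit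
  sphere of \<open>V\<close>; varying the minimizer along \<open>y\<close> gives the eigenvalue
  equation tested against \<open>V\<close>. The case \<open>g = id\<close> feeds the spectral
  theorem, a general \<open>g\<close> the matrix pencils.\<close>

lemma Rayleigh_quotient_minimizer:
  fixes f g :: "'a::euclidean_space \<Rightarrow> 'a"
  assumes lin: "linear f" "linear g"
    and sym: "\<And>x y. x \<bullet> f y = f x \<bullet> y" "\<And>x y. x \<bullet> g y = g x \<bullet> y"
    and V: "subspace V" "z \<in> V" "z \<noteq> 0"
    and pos: "\<And>y. y \<in> V \<Longrightarrow> y \<noteq> 0 \<Longrightarrow> y \<bullet> g y > 0"
  obtains x c where "x \<in> V" "x \<noteq> 0" "\<And>y. y \<in> V \<Longrightarrow> c * (y \<bullet> g y) \<le> y \<bullet> f y"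
    "\<And>y. y \<in> V \<Longrightarrow> y \<bullet> f x = c * (y \<bullet> g x)"
proof -
  have bl: "bounded_linear f" "bounded_linear g"
    using lin by (simp_all add: linear_conv_bounded_linear)
  have "compact (V \<inter> sphere 0 1)"
    by (intro closed_Int_compact closed_subspace V compact_sphere)
  moreover have "z /\<^sub>R norm z \<in> V \<inter> sphere 0 1"
    using V by (simp add: subspace_scale)
  moreover have "continuous_on (V \<inter> sphere 0 1) (\<lambda>x. (x \<bullet> f x) / (x \<bullet> g x))"
    using pos by (intro continuous_intros bounded_linear.continuous_on[OF bl(1)]
        bounded_linear.continuous_on[OF bl(2)]) force
  ultimately obtain x where x: "x \<in> V \<inter> sphere 0 1"
    and min: "\<And>y. y \<in> V \<inter> sphere 0 1 \<Longrightarrow> (x \<bullet> f x) / (x \<bullet> g x) \<le> (y \<bullet> f y) / (y \<bullet> g y)"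
    using continuous_attains_inf[of "V \<inter> sphere 0 1" "\<lambda>x. (x \<bullet> f x) / (x \<bullet> g x)"] by blast
  define c where "c = (x \<bullet> f x) / (x \<bullet> g x)"
  have xV: "x \<in> V" "x \<noteq> 0" using x by auto
  have le: "c * (y \<bullet> g y) \<le> y \<bullet> f y" if "y \<in> V" for y
  proof (cases "y = 0")
    case True
    then show ?thesis by simp
  next
    case False
    have "c \<le> (y \<bullet> f y) / (y \<bullet> g y)"
      using min[of "y /\<^sub>R norm y"] that V(1) False lin
      by (simp add: c_def linear_scale subspace_scale field_simps)
    then show ?thesis using pos[OF that False] by (simp add: field_simps)
  qed
  have eq: "x \<bullet> f x = c * (x \<bullet> g x)" using pos[OF xV] by (simp add: c_def)
  have "y \<bullet> f x = c * (y \<bullet> g x)" if "y \<in> V" for y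
  proof -
    \<comment> \<open>Expanding \<open>le\<close> at \<open>x + t y\<close> and cancelling the
      equality at \<open>x\<close> leaves a quadratic in \<open>t\<close> without constant
      term.\<close>
    have "0 \<le> 2 * t * (y \<bullet> f x - c * (y \<bullet> g x)) + t\<^sup>2 * (y \<bullet> f y - c * (y \<bullet> g y))" for t
    proof -
      have "x + t *\<^sub>R y \<in> V" using that xV V(1) by (simp add: subspace_add subspace_scale)
      from le[OF this]
      have "c * (x \<bullet> g x + 2 * t * (y \<bullet> g x) + t\<^sup>2 * (y \<bullet> g y))
          \<le> x \<bullet> f x + 2 * t * (y \<bullet> f x) + t\<^sup>2 * (y \<bullet> f y)"
        using sym(1)[of x y] sym(2)[of x y]
        by (simp add: linear_add[OF lin(1)] linear_add[OF lin(2)] linear_scale[OF lin(1)]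
            linear_scale[OF lin(2)] inner_left_distrib inner_right_distrib power2_eq_square
            inner_commute algebra_simps)
      then show ?thesis using eq by (simp add: algebra_simps)
    qed
    from quadratic_nonneg_imp_linear_zero[OF this] show ?thesis by simp
  qed
  with xV le that show ?thesis by blast
qed

text \<open>Induction on the dimension: a minimizer of the Rayleigh quotient in \<open>V\<close> is
  an eigenvector, and symmetry makes its orthogonal complement within \<open>V\<close> invariant
  under \<open>f\<close>.\<close>

lemma selfadjoint_orthonormal_eigenbasis:
  fixes f :: "'a::euclidean_space \<Rightarrow> 'a"
  assumes lin: "linear f" and sym: "\<And>x y. x \<bullet> f y = f x \<bullet> y"
    and V: "subspace V" "f ` V \<subseteq> V"
  shows "\<exists>E. finite E \<and> pairwise orthogonal E \<and> (\<forall>e\<in>E. norm e = 1 \<and> (\<exists>c. f e = c *\<^sub>R e)) \<and> span E = V"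
  using V
proof (induction "dim V" arbitrary: V rule: less_induct)
  case less
  show ?case
  proof (cases "V = {0}")
    case True
    then show ?thesis by (intro exI[of _ "{}"]) auto
  next
    case False
    then obtain z where "z \<in> V" "z \<noteq> 0"
      using less.prems subspace_0 by blast
    moreover have "y \<bullet> id y > 0" if "y \<noteq> 0" for y :: 'a
      using that by simp
    ultimately obtain x c where x: "x \<in> V" "x \<noteq> 0"
      and "\<And>y. y \<in> V \<Longrightarrow> y \<bullet> f x = c * (y \<bullet> id x)"
      by (rule_tac Rayleigh_quotient_minimizer[OF lin linear_id sym _ less.prems(1), of z]) auto
    then have c: "\<And>y. y \<in> V \<Longrightarrow> y \<bullet> f x = c * (y \<bullet> x)" by simp
    \<comment> \<open>Invariance of \<open>V\<close> puts the residual in \<open>V\<close>, so it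
      can be tested against itself.\<close>
    have "f x - c *\<^sub>R x \<in> V"
      using less.prems x by (intro subspace_diff subspace_scale) auto
    from c[OF this] have "(f x - c *\<^sub>R x) \<bullet> (f x - c *\<^sub>R x) = 0"
      by (simp add: inner_diff_right)
    then have fx: "f x = c *\<^sub>R x" by simp
    define e where "e = x /\<^sub>R norm x"
    have e: "e \<in> V" "norm e = 1" "f e = c *\<^sub>R e"
      using x less.prems(1) fx by (simp_all add: e_def subspace_scale linear_scale[OF lin])
    define W where "W = {y \<in> V. y \<bullet> e = 0}"
    have "W = V \<inter> {y. e \<bullet> y = 0}" by (auto simp: W_def inner_commute)
    then have W: "subspace W"
      using less.prems(1) by (metis subspace_hyperplane subspace_inter)
    have "e \<notin> W" using e by (auto simp: W_def)
    moreover have "W \<subseteq> V" by (auto simp: W_def)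
    ultimately have "W \<subset> V" using e(1) by blast
    then have "dim W < dim V"
      using W less.prems(1) by (intro dim_psubset) (simp add: span_eq_iff[THEN iffD2])
    moreover have "f ` W \<subseteq> W"
      using less.prems(2) e by (auto simp: W_def simp flip: sym)
    ultimately obtain E where E: "finite E" "pairwise orthogonal E"
      "\<And>d. d \<in> E \<Longrightarrow> norm d = 1 \<and> (\<exists>c. f d = c *\<^sub>R d)" "span E = W"
      using less.hyps W by metis
    have "E \<subseteq> W" using E(4) span_superset by blast
    then have "pairwise orthogonal (insert e E)"
      using E(2) by (auto simp: pairwise_insert orthogonal_def W_def inner_commute)
    moreover have "span (insert e E) = V"
    proof
      show "span (insert e E) \<subseteq> V"
        using \<open>E \<subseteq> W\<close> e less.prems(1) by (intro span_minimal) (auto simp: W_def)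
      show "V \<subseteq> span (insert e E)"
      proof
        fix y assume "y \<in> V"
        then have "y - (y \<bullet> e) *\<^sub>R e \<in> W"
          using e less.prems(1)
          by (simp add: W_def subspace_diff subspace_scale inner_diff_left dot_square_norm)
        then show "y \<in> span (insert e E)"
          using E(4) by (auto simp: span_insert)
      qed
    qed
    ultimately show ?thesis
      using E e by (intro exI[of _ "insert e E"]) auto
  qed
qed

section \<open>Symmetric matrices\<close>

lemma inner_symmetric_matrix:
  fixes A :: "real ^ 'n ^ 'n"
  assumes "transpose A = A"
  shows "x \<bullet> (A *v y) = (A *v x) \<bullet> y"
  by (metis assms dot_lmul_matrix transpose_matrix_vector)

lemma symmetric_matrixI:
  fixes A :: "real ^ 'n ^ 'n"
  assumes "\<And>x y. x \<bullet> (A *v y) = (A *v x) \<bullet> y"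
  shows "transpose A = A"
proof -
  have "y \<bullet> (transpose A *v x) = y \<bullet> (A *v x)" for x y
    by (metis assms dot_lmul_matrix transpose_matrix_vector inner_commute)
  then have "transpose A *v x = A *v x" for x
    using vector_eq_ldot by metis
  then show ?thesis
    unfolding matrix_eq by blast
qed

lemma spd_invertible:
  assumes "spd A" shows "invertible A"
proof -
  have "A *v x = 0 \<Longrightarrow> x = 0" for x
    using assms by (metis spd_def inner_zero_right less_irrefl)
  then show ?thesis
    using invertible_left_inverse matrix_left_invertible_ker by blast
qed

text \<open>On an orthonormal eigenbasis of \<open>B\<close>, each eigenvalue is replaced by its
  square root; positivity of \<open>B\<close> makes the eigenvalues positive.\<close>

lemma spd_sqrt_exists:
  fixes B :: "real ^ 'n ^ 'n"
  assumes "spd B"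
  shows "\<exists>S. spd S \<and> S ** S = B"
proof -
  have sym: "x \<bullet> (B *v y) = (B *v x) \<bullet> y" for x y
    using assms inner_symmetric_matrix unfolding spd_def by blast
  obtain E where E: "finite E" "pairwise orthogonal E" "\<And>e. e \<in> E \<Longrightarrow> norm e = 1"
    "\<forall>e\<in>E. \<exists>c. B *v e = c *\<^sub>R e" "span E = UNIV"
    using selfadjoint_orthonormal_eigenbasis[of "(*v) B" UNIV] sym by auto
  obtain c where c: "\<And>e. e \<in> E \<Longrightarrow> B *v e = c e *\<^sub>R e" using E(4) by metis
  have ee: "e \<bullet> d = (if e = d then 1 else 0)" if "e \<in> E" "d \<in> E" for e d
    using E(2,3) that by (auto simp: pairwise_def orthogonal_def dot_square_norm)
  have cpos: "c e > 0" if "e \<in> E" for e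
  proof -
    have "e \<noteq> 0" using E(3)[OF that] by auto
    then have "e \<bullet> (B *v e) > 0" using assms by (auto simp: spd_def)
    then show ?thesis using ee[OF that that] c[OF that] by simp
  qed
  \<comment> \<open>Vectors are determined by their coefficients against \<open>E\<close>, which
    reduces \<open>S ** S = B\<close> to one scalar identity per eigenvector.\<close>
  have ext: "x = y" if "\<And>e. e \<in> E \<Longrightarrow> e \<bullet> x = e \<bullet> y" for x y :: "real ^ 'n"
  proof -
    have "orthogonal (x - y) e" if "e \<in> E" for e
      using \<open>\<And>e. e \<in> E \<Longrightarrow> e \<bullet> x = e \<bullet> y\<close>[OF that]
      by (simp add: orthogonal_def inner_diff_right inner_commute[of _ e])
    then have "orthogonal (x - y) e" if "e \<in> span E" for e
      using orthogonal_to_span that by blast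
    then have "(x - y) \<bullet> (x - y) = 0" using E(5) by (simp add: orthogonal_def)
    then show ?thesis by simp
  qed
  define s where "s x = (\<Sum>e\<in>E. (sqrt (c e) * (e \<bullet> x)) *\<^sub>R e)" for x
  have lin: "linear s"
    by (rule linearI) (simp_all add: s_def inner_right_distrib distrib_left scaleR_left_distrib
        sum.distrib scaleR_sum_right mult_ac)
  have es: "e \<bullet> s x = sqrt (c e) * (e \<bullet> x)" if "e \<in> E" for e x
  proof -
    have "e \<bullet> s x = (\<Sum>d\<in>E. if e = d then sqrt (c d) * (d \<bullet> x) else 0)"
      unfolding s_def inner_sum_right using ee that by (intro sum.cong) auto
    then show ?thesis using that E(1) by simp
  qed
  have xs: "y \<bullet> s x = (\<Sum>e\<in>E. sqrt (c e) * (e \<bullet> x) * (e \<bullet> y))" for x y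
    by (simp add: s_def inner_sum_right inner_commute)
  define S where "S = matrix s"
  have S: "S *v x = s x" for x unfolding S_def by (simp add: lin)
  have "transpose S = S"
    by (rule symmetric_matrixI) (simp add: S xs inner_commute[of "s _"] mult_ac)
  moreover have "x \<bullet> (S *v x) > 0" if "x \<noteq> 0" for x
  proof -
    obtain e where "e \<in> E" "e \<bullet> x \<noteq> 0" using ext[of x 0] \<open>x \<noteq> 0\<close> by auto
    then show ?thesis unfolding S xs
      using cpos E(1) by (intro sum_pos2[of _ e]) (auto simp: mult.assoc less_imp_le zero_less_mult_iff)
  qed
  moreover have "S ** S = B"
  proof -
    have "(S ** S) *v x = B *v x" for x
    proof (rule ext)
      fix e assume e: "e \<in> E"
      have "e \<bullet> ((S ** S) *v x) = c e * (e \<bullet> x)"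
        using es[OF e] cpos[OF e] by (simp add: S flip: matrix_vector_mul_assoc mult.assoc)
      also have "\<dots> = e \<bullet> (B *v x)"
        using c[OF e] sym by simp
      finally show "e \<bullet> ((S ** S) *v x) = e \<bullet> (B *v x)" .
    qed
    then show ?thesis by (simp add: matrix_eq)
  qed
  ultimately show ?thesis unfolding spd_def by blast
qed

text \<open>The difference \<open>d\<close> is symmetric, and equality of the squares means
  \<open>d S + T d = 0\<close>. Pairing this with an eigenvector of \<open>d\<close> forces its
  eigenvalue to be 0, since \<open>S\<close> and \<open>T\<close> are positive; so \<open>d\<close>
  vanishes on an eigenbasis.\<close>

lemma spd_sqrt_unique:
  fixes S T :: "real ^ 'n ^ 'n"
  assumes S: "spd S" and T: "spd T" and eq: "S ** S = T ** T"
  shows "S = T"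
proof -
  define d where "d x = S *v x - T *v x" for x
  have lin: "linear d"
    unfolding d_def by (intro linear_compose_sub matrix_vector_mul_linear)
  have sym: "x \<bullet> d y = d x \<bullet> y" for x y
    using S T unfolding d_def spd_def
    by (simp add: inner_diff_left inner_diff_right inner_symmetric_matrix)
  obtain E where E: "\<And>e. e \<in> E \<Longrightarrow> norm e = 1 \<and> (\<exists>c. d e = c *\<^sub>R e)" "span E = UNIV"
    using selfadjoint_orthonormal_eigenbasis[OF lin sym, of UNIV] by auto
  have "d e = 0" if "e \<in> E" for e
  proof -
    from E(1)[OF that] obtain c where e: "norm e = 1" and c: "d e = c *\<^sub>R e" by blast
    have "S *v (S *v e) = T *v (T *v e)"
      using eq by (simp add: matrix_vector_mul_assoc)
    then have "d (S *v e) + T *v d e = 0"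
      by (simp add: d_def matrix_vector_mult_diff_distrib)
    then have "0 = e \<bullet> d (S *v e) + e \<bullet> (T *v d e)"
      by (metis inner_add_right inner_zero_right)
    also have "\<dots> = c * (e \<bullet> (S *v e) + e \<bullet> (T *v e))"
      by (simp add: sym c matrix_vector_mult_scaleR algebra_simps)
    finally have "c = 0 \<or> e \<bullet> (S *v e) + e \<bullet> (T *v e) = 0" by simp
    moreover have "e \<noteq> 0" using e by auto
    ultimately have "c = 0"
      using S T by (smt (verit) spd_def)
    then show ?thesis by (simp add: c)
  qed
  then have "d x = 0" for x
    using linear_eq_0_on_span[OF lin, of E x] E(2) by auto
  then show ?thesis by (simp add: d_def matrix_eq)
qed

lemma
  assumes "spd B"
  shows spd_spd_sqrt: "spd (spd_sqrt B)"
    and spd_sqrt_mult_self: "spd_sqrt B ** spd_sqrt B = B"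
proof -
  have "\<exists>!S. spd S \<and> S ** S = B"
    using spd_sqrt_exists[OF assms] spd_sqrt_unique by metis
  from theI'[OF this] show "spd (spd_sqrt B)" "spd_sqrt B ** spd_sqrt B = B"
    unfolding spd_sqrt_def by blast+
qed

section \<open>Derivatives along the unit sphere\<close>

text \<open>The great circle through \<open>x\<close> with direction \<open>v\<close> turns a derivative within the sphere
  into an ordinary derivative of a function of one real variable.\<close>

lemma has_derivative_within_sphere_unique_tangent:
  fixes f :: "'a::euclidean_space \<Rightarrow> 'b::real_normed_vector"
  assumes x: "norm x = 1" and v: "v \<in> tangent_space x"
    and F: "(f has_derivative F) (at x within sphere 0 1)"
    and G: "(f has_derivative G) (at x within sphere 0 1)"
  shows "F v = G v"
proof (cases "v = 0")
  case True
  then show ?thesis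
    using F G by (simp add: has_derivative_bounded_linear linear_simps)
next
  case False
  \<comment> \<open>Normalization keeps the curve \<open>\<gamma>\<close> on the unit sphere; the
    factor \<open>norm v\<close> is restored by linearity at the end.\<close>
  define w where "w = v /\<^sub>R norm v"
  have w: "norm w = 1" "x \<bullet> w = 0"
    using v False by (simp_all add: w_def tangent_space_def inner_commute)
  define \<gamma> where "\<gamma> t = cos t *\<^sub>R x + sin t *\<^sub>R w" for t
  have "\<gamma> t \<bullet> \<gamma> t = 1" for t
  proof -
    have "\<gamma> t \<bullet> \<gamma> t = (cos t)\<^sup>2 * (x \<bullet> x) + (sin t)\<^sup>2 * (w \<bullet> w)"
      by (simp only: \<gamma>_def inner_add_left inner_add_right inner_scaleR_left inner_scaleR_right
          inner_commute[of w x] w(2) power2_eq_square) simp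
    also have "\<dots> = 1"
      unfolding norm_eq_1[THEN iffD1, OF x] norm_eq_1[THEN iffD1, OF w(1)] by simp
    finally show ?thesis .
  qed
  then have \<gamma>1: "\<gamma> ` UNIV \<subseteq> sphere 0 1"
    by (auto simp: norm_eq_sqrt_inner)
  have \<gamma>: "(\<gamma> has_derivative (\<lambda>t. t *\<^sub>R w)) (at 0 within UNIV)"
    unfolding \<gamma>_def by (auto intro!: derivative_eq_intros)
  have "((\<lambda>t. f (\<gamma> t)) has_derivative (\<lambda>t. H (t *\<^sub>R w))) (at 0)"
    if "(f has_derivative H) (at x within sphere 0 1)" for H
  proof -
    have "(f has_derivative H) (at (\<gamma> 0) within \<gamma> ` UNIV)"
      using that \<gamma>1 by (auto simp: \<gamma>_def intro: has_derivative_subset)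
    from has_derivative_in_compose[OF \<gamma> this] show ?thesis by simp
  qed
  from has_derivative_unique[OF this[OF F] this[OF G]]
  have "F (norm v *\<^sub>R w) = G (norm v *\<^sub>R w)" by metis
  then show ?thesis using False by (simp add: w_def)
qed

text \<open>Two candidates \<open>k\<close> and \<open>g\<close> agree as functionals on tangent
  vectors. Their difference is itself tangent, so it is orthogonal to itself.\<close>

lemma riemannian_grad_eqI:
  assumes x: "norm x = 1" and g: "g \<in> tangent_space x"
    and f: "(f has_derivative (\<lambda>h. g \<bullet> h)) (at x within sphere 0 1)"
  shows "riemannian_grad f x = g"
  unfolding riemannian_grad_def
proof (rule the_equality)
  fix k assume k: "k \<in> tangent_space x \<and> (f has_derivative (\<bullet>) k) (at x within sphere 0 1)"
  then have "k - g \<in> tangent_space x"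
    using g by (simp add: tangent_space_def inner_diff_left)
  then have "k \<bullet> (k - g) = g \<bullet> (k - g)"
    using has_derivative_within_sphere_unique_tangent[OF x _ conjunct2[OF k] f] by blast
  then have "(k - g) \<bullet> (k - g) = 0" by (simp add: inner_diff_left)
  then show "k = g" by simp
qed (use g f in auto)

text \<open>Derivatives within the sphere are not unique in the normal direction, but they agree on
  tangent vectors; hence any computed derivative \<open>F\<close> can stand in for the chosen
  one.\<close>

lemma covariant_deriv_eq:
  assumes x: "norm x = 1" and v: "v \<in> tangent_space x"
    and X: "(X has_derivative F) (at x within sphere 0 1)"
  shows "covariant_deriv X x v = tangent_proj x (F v)"
proof -
  have "(X has_derivative frechet_derivative X (at x within sphere 0 1)) (at x within sphere 0 1)"
    using X differentiableI frechet_derivative_works by blast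
  from has_derivative_within_sphere_unique_tangent[OF x v this X] show ?thesis
    by (simp add: covariant_deriv_def)
qed

lemma inner_tangent_proj:
  "v \<in> tangent_space x \<Longrightarrow> v \<bullet> tangent_proj x w = v \<bullet> w"
  by (simp add: tangent_proj_def tangent_space_def inner_diff_right)

section \<open>The Rayleigh quotient on the sphere\<close>

text \<open>The Euclidean gradient for symmetric \<open>A\<close> and \<open>M\<close>. Since the
  quotient is homogeneous of degree 0, it is already orthogonal to \<open>x\<close> and equals the
  Riemannian gradient on the sphere without projection.\<close>

definition Rq_grad :: "real ^ 'n ^ 'n \<Rightarrow> real ^ 'n ^ 'n \<Rightarrow> real ^ 'n \<Rightarrow> real ^ 'n" where
  "Rq_grad A M x = (2 / (x \<bullet> (M *v x))) *\<^sub>R (A *v x - Rq A M x *\<^sub>R (M *v x))"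

lemma has_derivative_matrix_vector_mult [derivative_intros]:
  fixes A :: "real ^ 'n ^ 'm"
  assumes "(f has_derivative f') F"
  shows "((\<lambda>x. A *v f x) has_derivative (\<lambda>h. A *v f' h)) F"
  by (rule bounded_linear.has_derivative[OF matrix_vector_mul_bounded_linear assms])

lemma has_derivative_Rq:
  fixes A M :: "real ^ 'n ^ 'n"
  assumes "transpose A = A" "transpose M = M" "x \<bullet> (M *v x) \<noteq> 0"
  shows "(Rq A M has_derivative (\<lambda>h. Rq_grad A M x \<bullet> h)) (at x within S)"
proof -
  have "(Rq A M has_derivative (\<lambda>h. ((h \<bullet> (A *v x) + x \<bullet> (A *v h)) * (x \<bullet> (M *v x))
      - (x \<bullet> (A *v x)) * (h \<bullet> (M *v x) + x \<bullet> (M *v h))) / (x \<bullet> (M *v x))\<^sup>2)) (at x within S)"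
    unfolding Rq_def[abs_def] using assms(3)
    by (auto intro!: derivative_eq_intros simp: power2_eq_square add.commute)
  also have "(\<lambda>h. ((h \<bullet> (A *v x) + x \<bullet> (A *v h)) * (x \<bullet> (M *v x))
      - (x \<bullet> (A *v x)) * (h \<bullet> (M *v x) + x \<bullet> (M *v h))) / (x \<bullet> (M *v x))\<^sup>2)
      = (\<lambda>h. Rq_grad A M x \<bullet> h)"
    using assms(3) inner_symmetric_matrix[OF assms(1), of x] inner_symmetric_matrix[OF assms(2), of x]
    by (simp add: Rq_grad_def Rq_def fun_eq_iff inner_diff_left inner_commute[of _ "_ *v x"]
        field_simps power2_eq_square)
  finally show ?thesis .
qed

lemma riemannian_grad_Rq:
  fixes A M :: "real ^ 'n ^ 'n"
  assumes "transpose A = A" "transpose M = M" "x \<bullet> (M *v x) \<noteq> 0" "norm x = 1"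
  shows "riemannian_grad (Rq A M) x = Rq_grad A M x"
proof (rule riemannian_grad_eqI)
  show "Rq_grad A M x \<in> tangent_space x"
    using assms(3) by (simp add: tangent_space_def Rq_grad_def Rq_def inner_diff_left
        inner_commute[of "_ *v x"])
qed (use assms has_derivative_Rq in auto)

text \<open>The Riemannian gradient agrees with \<open>Rq_grad\<close> on the sphere, so the ambient
  derivative of \<open>Rq_grad\<close> can be used, and pairing with a tangent vector removes the
  projection.\<close>

lemma inner_riemannian_hess_Rq:
  fixes A M :: "real ^ 'n ^ 'n"
  assumes A: "transpose A = A" and M: "spd M" and x: "norm x = 1" and v: "v \<in> tangent_space x"
  shows "v \<bullet> riemannian_hess (Rq A M) x v =
    2 / (x \<bullet> (M *v x)) * (v \<bullet> (A *v v) - Rq A M x * (v \<bullet> (M *v v)))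
    - 8 / (x \<bullet> (M *v x))\<^sup>2 * (v \<bullet> (A *v x - Rq A M x *\<^sub>R (M *v x))) * (v \<bullet> (M *v x))"
proof -
  have Ms: "transpose M = M" and Mpos: "\<And>y. y \<noteq> 0 \<Longrightarrow> y \<bullet> (M *v y) > 0"
    using M by (auto simp: spd_def)
  have m: "x \<bullet> (M *v x) \<noteq> 0" using Mpos[of x] x by force
  have grad: "riemannian_grad (Rq A M) y = Rq_grad A M y" if "y \<in> sphere 0 1" for y
    using that Mpos[of y] by (intro riemannian_grad_Rq A Ms) force+
  define m where "m = x \<bullet> (M *v x)"
  define r where "r = Rq A M x"
  \<comment> \<open>Product rule: the first summand differentiates the residual, including
    \<open>r\<close>, and the second differentiates the factor \<open>2 / m\<close>.\<close>
  define D where "D h = (2 / m) *\<^sub>R (A *v h - r *\<^sub>R (M *v h) - (Rq_grad A M x \<bullet> h) *\<^sub>R (M *v x))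
      - (2 * (h \<bullet> (M *v x) + x \<bullet> (M *v h)) / m\<^sup>2) *\<^sub>R (A *v x - r *\<^sub>R (M *v x))" for h
  have "(Rq_grad A M has_derivative D) (at x within sphere 0 1)"
    unfolding Rq_grad_def[abs_def] using m
    by (auto intro!: derivative_eq_intros has_derivative_Rq A Ms
      simp: D_def[abs_def] m_def r_def fun_eq_iff vec_eq_iff power2_eq_square field_simps)
  then have "(riemannian_grad (Rq A M) has_derivative D) (at x within sphere 0 1)"
    by (rule has_derivative_transform[rotated 2]) (use grad x in auto)
  from covariant_deriv_eq[OF x v this]
  have "v \<bullet> riemannian_hess (Rq A M) x v = v \<bullet> D v"
    by (simp add: riemannian_hess_def inner_tangent_proj[OF v])
  \<comment> \<open>The derivative of \<open>r\<close> and the derivative of \<open>2 / m\<close>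
    each contribute 4 to the coefficient 8.\<close>
  also have "\<dots> = 2 / m * (v \<bullet> (A *v v) - r * (v \<bullet> (M *v v)))
      - 8 / m\<^sup>2 * (v \<bullet> (A *v x - r *\<^sub>R (M *v x))) * (v \<bullet> (M *v x))"
    using inner_symmetric_matrix[OF Ms, of x v] m unfolding m_def[symmetric]
    by (simp add: D_def Rq_grad_def inner_diff_left inner_diff_right flip: m_def r_def)
      (simp add: inner_commute[of "_ *v x"] field_simps power2_eq_square)
  finally show ?thesis by (simp add: m_def r_def)
qed

section \<open>Extremal eigenvalues\<close>

text \<open>With \<open>V\<close> the whole space, the tested equation of the minimizer is a genuine
  generalized eigenvalue equation.\<close>

lemma pencil_min_eigenvector:
  fixes A M :: "real ^ 'n ^ 'n"
  assumes A: "transpose A = A" and M: "spd M"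
  obtains x c where "x \<noteq> 0" "A *v x = c *\<^sub>R (M *v x)" "\<And>y. c * (y \<bullet> (M *v y)) \<le> y \<bullet> (A *v y)"
proof -
  \<comment> \<open>Any nonzero vector serves as the witness that the space is nontrivial.\<close>
  have "axis undefined (1::real) \<noteq> (0 :: real ^ 'n)" by (simp add: axis_eq_0_iff)
  moreover have "transpose M = M" "\<And>y. y \<noteq> 0 \<Longrightarrow> y \<bullet> (M *v y) > 0"
    using M by (auto simp: spd_def)
  ultimately obtain x c where x: "x \<noteq> 0" and le: "\<And>y. c * (y \<bullet> (M *v y)) \<le> y \<bullet> (A *v y)"
    and eq: "\<And>y. y \<bullet> (A *v x) = c * (y \<bullet> (M *v x))"
    using Rayleigh_quotient_minimizer[of "(*v) A" "(*v) M" UNIV "axis undefined 1"]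
      inner_symmetric_matrix A by (metis UNIV_I matrix_vector_mul_linear subspace_UNIV)
  have "A *v x = c *\<^sub>R (M *v x)"
    by (metis eq inner_scaleR_right vector_eq_ldot)
  with x le that show ?thesis by blast
qed

text \<open>Negating \<open>A\<close> turns the maximum into a minimum.\<close>

lemma pencil_max_eigenvector:
  fixes A M :: "real ^ 'n ^ 'n"
  assumes A: "transpose A = A" and M: "spd M"
  obtains x c where "x \<noteq> 0" "A *v x = c *\<^sub>R (M *v x)" "\<And>y. y \<bullet> (A *v y) \<le> c * (y \<bullet> (M *v y))"
proof -
  have neg: "(- A) *v y = - (A *v y)" for y
    using matrix_vector_mult_diff_rdistrib[of 0 A y] by simp
  have "transpose (- A) = - A"
    using A by (simp add: transpose_def vec_eq_iff)
  from pencil_min_eigenvector[OF this M]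
  obtain x c where "x \<noteq> 0" "- (A *v x) = c *\<^sub>R (M *v x)"
    "\<And>y. c * (y \<bullet> (M *v y)) \<le> - (y \<bullet> (A *v y))"
    unfolding neg inner_minus_right by blast
  then show ?thesis
    by (intro that[of x "- c"]) (auto simp: minus_equation_iff[of "A *v x"] le_minus_iff[of "c * _"])
qed

text \<open>An eigenvector makes \<open>A - c M\<close> singular; as \<open>det M\<close> is
  nonzero, some factor of the characteristic product must vanish.\<close>

lemma pencil_eigenvalues_root:
  fixes A M :: "real ^ 'n ^ 'n"
  assumes lam: "pencil_eigenvalues A M lam" and M: "spd M"
    and x: "x \<noteq> 0" "A *v x = c *\<^sub>R (M *v x)"
  shows "\<exists>i\<in>{1..CARD('n)}. lam i = c"
proof -
  have "(A - c *\<^sub>R M) *v x = 0"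
    using x(2) by (simp add: matrix_vector_mult_diff_rdistrib scaleR_matrix_vector_assoc)
  then have "\<not> invertible (A - c *\<^sub>R M)"
    using x(1) invertible_left_inverse matrix_left_invertible_ker by blast
  then have "det M * (\<Prod>i = 1..CARD('n). lam i - c) = 0"
    using lam by (simp add: pencil_eigenvalues_def invertible_det_nz)
  then show ?thesis
    using spd_invertible[OF M] by (auto simp: invertible_det_nz)
qed

text \<open>The extremal values of the Rayleigh quotient are eigenvalues, hence entries of
  \<open>lam\<close>, and monotonicity places them between its first and last entry.\<close>

lemma pencil_eigenvalues_bounds:
  fixes A M :: "real ^ 'n ^ 'n"
  assumes lam: "pencil_eigenvalues A M lam" and A: "transpose A = A" and M: "spd M"
  shows "lam 1 * (y \<bullet> (M *v y)) \<le> y \<bullet> (A *v y)"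
    and "y \<bullet> (A *v y) \<le> lam CARD('n) * (y \<bullet> (M *v y))"
proof -
  have pos: "y \<bullet> (M *v y) \<ge> 0" using M by (cases "y = 0") (auto simp: spd_def less_imp_le)
  have mono: "lam i \<le> lam j" if "i \<in> {1..CARD('n)}" "j \<in> {1..CARD('n)}" "i \<le> j" for i j
    using lam that by (auto simp: pencil_eigenvalues_def mono_on_def)
  obtain x c where "x \<noteq> 0" "A *v x = c *\<^sub>R (M *v x)" and c: "c * (y \<bullet> (M *v y)) \<le> y \<bullet> (A *v y)"
    using pencil_min_eigenvector[OF A M] by metis
  then obtain i where "i \<in> {1..CARD('n)}" "lam i = c" using pencil_eigenvalues_root[OF lam M] by blast
  then have "lam 1 \<le> c" using mono[of 1 i] by auto
  then have "lam 1 * (y \<bullet> (M *v y)) \<le> c * (y \<bullet> (M *v y))" using pos by (rule mult_right_mono)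
  with c show "lam 1 * (y \<bullet> (M *v y)) \<le> y \<bullet> (A *v y)" by linarith
  obtain x c where "x \<noteq> 0" "A *v x = c *\<^sub>R (M *v x)" and c: "y \<bullet> (A *v y) \<le> c * (y \<bullet> (M *v y))"
    using pencil_max_eigenvector[OF A M] by metis
  then obtain i where "i \<in> {1..CARD('n)}" "lam i = c" using pencil_eigenvalues_root[OF lam M] by blast
  then have "c \<le> lam CARD('n)" using mono[of i "CARD('n)"] by auto
  then have "c * (y \<bullet> (M *v y)) \<le> lam CARD('n) * (y \<bullet> (M *v y))" using pos by (rule mult_right_mono)
  with c show "y \<bullet> (A *v y) \<le> lam CARD('n) * (y \<bullet> (M *v y))" by linarith
qed

text \<open>Eigenvectors for distinct eigenvalues are orthogonal, and an orthogonal set in finite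
  dimension is finite. This makes \<open>Min\<close> and \<open>Max\<close> of the spectrum
  meaningful.\<close>

lemma finite_eigenvalues_symmetric:
  fixes A :: "real ^ 'n ^ 'n"
  assumes A: "transpose A = A"
  shows "finite (eigenvalues A)"
proof -
  have "\<forall>c\<in>eigenvalues A. \<exists>v. v \<noteq> 0 \<and> A *v v = c *\<^sub>R v"
    by (simp add: eigenvalues_def)
  then obtain u where u: "\<And>c. c \<in> eigenvalues A \<Longrightarrow> u c \<noteq> 0 \<and> A *v u c = c *\<^sub>R u c"
    using bchoice by metis
  have orth: "u c \<bullet> u d = 0" if "c \<in> eigenvalues A" "d \<in> eigenvalues A" "c \<noteq> d" for c d
  proof -
    have "d * (u c \<bullet> u d) = c * (u c \<bullet> u d)"
      using inner_symmetric_matrix[OF A, of "u c" "u d"] u that by simp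
    then show ?thesis using \<open>c \<noteq> d\<close> by simp
  qed
  have "pairwise orthogonal (u ` eigenvalues A)"
    using orth by (auto simp: pairwise_def orthogonal_def)
  then have "finite (u ` eigenvalues A)"
    by (rule pairwise_orthogonal_imp_finite)
  moreover have "inj_on u (eigenvalues A)"
    using orth u by (metis inj_onI inner_eq_zero_iff)
  ultimately show ?thesis by (rule finite_imageD)
qed

lemma spd_mat_1: "spd (mat 1 :: real ^ 'n ^ 'n)"
  by (simp add: spd_def transpose_mat)

text \<open>The pencil argument with the identity as second matrix.\<close>

lemma eigenvalues_bounds_symmetric:
  fixes A :: "real ^ 'n ^ 'n"
  assumes A: "transpose A = A"
  shows "Min (eigenvalues A) * (norm y)\<^sup>2 \<le> y \<bullet> (A *v y)"
    and "y \<bullet> (A *v y) \<le> Max (eigenvalues A) * (norm y)\<^sup>2"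
proof -
  obtain x c where "x \<noteq> 0" "A *v x = c *\<^sub>R x" and c: "c * (norm y)\<^sup>2 \<le> y \<bullet> (A *v y)"
    using pencil_min_eigenvector[OF A spd_mat_1] by (metis dot_square_norm matrix_vector_mul_lid)
  then have "c \<in> eigenvalues A" by (auto simp: eigenvalues_def)
  then have "Min (eigenvalues A) \<le> c"
    using finite_eigenvalues_symmetric[OF A] by simp
  with c show "Min (eigenvalues A) * (norm y)\<^sup>2 \<le> y \<bullet> (A *v y)"
    by (smt (verit) mult_right_mono zero_le_power2)
  obtain x c where "x \<noteq> 0" "A *v x = c *\<^sub>R x" and c: "y \<bullet> (A *v y) \<le> c * (norm y)\<^sup>2"
    using pencil_max_eigenvector[OF A spd_mat_1] by (metis dot_square_norm matrix_vector_mul_lid)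
  then have "c \<in> eigenvalues A" by (auto simp: eigenvalues_def)
  then have "c \<le> Max (eigenvalues A)"
    using finite_eigenvalues_symmetric[OF A] by simp
  with c show "y \<bullet> (A *v y) \<le> Max (eigenvalues A) * (norm y)\<^sup>2"
    by (smt (verit) mult_right_mono zero_le_power2)
qed

lemma spd_Min_eigenvalues_pos:
  assumes "spd A" shows "Min (eigenvalues A) > 0"
proof -
  have A: "transpose A = A" using assms by (simp add: spd_def)
  obtain x c where "x \<noteq> 0" "A *v x = c *\<^sub>R x"
    using pencil_min_eigenvector[OF A spd_mat_1] by (metis matrix_vector_mul_lid)
  then have "eigenvalues A \<noteq> {}" by (auto simp: eigenvalues_def)
  then have "Min (eigenvalues A) \<in> eigenvalues A"
    using finite_eigenvalues_symmetric[OF A] Min_in by blast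
  then obtain x where x: "x \<noteq> 0" "A *v x = Min (eigenvalues A) *\<^sub>R x"
    unfolding eigenvalues_def by blast
  then have "Min (eigenvalues A) * (x \<bullet> x) > 0"
    using assms by (metis inner_scaleR_right spd_def)
  moreover have "x \<bullet> x > 0" using x(1) by simp
  ultimately show ?thesis by (metis zero_less_mult_pos2)
qed

section \<open>Preconditioning\<close>

lemma spd_matrix_inv:
  fixes S :: "real ^ 'n ^ 'n"
  assumes "spd S"
  shows "spd (matrix_inv S)"
proof -
  have S: "S ** matrix_inv S = mat 1"
    using someI_ex[OF spd_invertible[OF assms, unfolded invertible_def]] by (simp add: matrix_inv_def)
  have SI: "S *v (matrix_inv S *v x) = x" for x
    by (simp add: matrix_vector_mul_assoc S)
  have sym: "x \<bullet> (S *v y) = (S *v x) \<bullet> y" for x y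
    using assms by (simp add: spd_def inner_symmetric_matrix)
  have "x \<bullet> (matrix_inv S *v y) = (matrix_inv S *v x) \<bullet> y" for x y
    using sym[of "matrix_inv S *v x" "matrix_inv S *v y"] by (simp add: SI)
  then have "transpose (matrix_inv S) = matrix_inv S" by (rule symmetric_matrixI)
  moreover have "x \<bullet> (matrix_inv S *v x) > 0" if "x \<noteq> 0" for x
  proof -
    have "matrix_inv S *v x \<noteq> 0" using SI[of x] that by auto
    then show ?thesis
      using assms by (metis SI inner_commute spd_def)
  qed
  ultimately show ?thesis by (simp add: spd_def)
qed

text \<open>Preconditioning is a congruence: the form of \<open>precond B A\<close> is that of
  \<open>A\<close> after a substitution not depending on \<open>A\<close>. Inequalities between the
  forms of \<open>A\<close> and \<open>M\<close> therefore carry over.\<close>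

lemma inner_precond:
  assumes "spd B"
  shows "x \<bullet> (precond B A *v y) = (matrix_inv (spd_sqrt B) *v x) \<bullet> (A *v (matrix_inv (spd_sqrt B) *v y))"
  using spd_matrix_inv[OF spd_spd_sqrt[OF assms]]
  by (simp add: precond_def spd_def inner_symmetric_matrix flip: matrix_vector_mul_assoc)

lemma spd_precond:
  assumes A: "spd A" and B: "spd B"
  shows "spd (precond B A)"
proof -
  define T where "T = matrix_inv (spd_sqrt B)"
  have "T *v x \<noteq> 0" if "x \<noteq> 0" for x
    using spd_matrix_inv[OF spd_spd_sqrt[OF B]] that unfolding T_def
    by (metis inner_zero_right less_irrefl spd_def)
  moreover have "transpose (precond B A) = precond B A"
    by (rule symmetric_matrixI)
      (use A in \<open>simp add: inner_precond[OF B] spd_def inner_symmetric_matrix inner_commute[of "precond B A *v _"]\<close>,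
       metis inner_commute inner_symmetric_matrix)
  ultimately show ?thesis
    using A by (simp add: spd_def inner_precond[OF B] flip: T_def)
qed

text \<open>The Euclidean inequality applied to the images of both vectors under the square root of
  \<open>A\<close>.\<close>

lemma spd_Cauchy_Schwarz:
  assumes "spd A"
  shows "\<bar>x \<bullet> (A *v y)\<bar> \<le> mnorm A x * mnorm A y"
proof -
  define S where "S = spd_sqrt A"
  have S: "spd S" "S ** S = A"
    unfolding S_def using assms by (rule spd_spd_sqrt spd_sqrt_mult_self)+
  have "u \<bullet> (A *v w) = (S *v u) \<bullet> (S *v w)" for u w
    using S by (metis inner_symmetric_matrix matrix_vector_mul_assoc spd_def)
  then show ?thesis
    by (simp add: mnorm_def Cauchy_Schwarz_ineq2 flip: norm_eq_sqrt_inner)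
qed

section \<open>Constants of the sublevel set\<close>

text \<open>Real infima are informative only for nonempty sets bounded below. Nonnegativity bounds
  \<open>F\<close> below, and nonemptiness of each \<open>V x\<close> passes the bound on to the
  inner infima.\<close>

lemma nested_INF_bounds:
  fixes F :: "'a \<Rightarrow> 'b \<Rightarrow> real"
  assumes x: "x \<in> X" and v: "v \<in> V x"
    and nonempty: "\<And>x. x \<in> X \<Longrightarrow> V x \<noteq> {}"
    and nonneg: "\<And>x v. x \<in> X \<Longrightarrow> v \<in> V x \<Longrightarrow> F x v \<ge> 0"
  shows "0 \<le> (INF x\<in>X. INF v\<in>V x. F x v)" and "(INF x\<in>X. INF v\<in>V x. F x v) \<le> F x v"
proof -
  have inner: "0 \<le> (INF v\<in>V y. F y v)" if "y \<in> X" for y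
    using that nonempty nonneg by (intro cINF_greatest) auto
  then show "0 \<le> (INF x\<in>X. INF v\<in>V x. F x v)"
    using x by (rule_tac cINF_greatest) auto
  have "(INF x\<in>X. INF v\<in>V x. F x v) \<le> (INF v\<in>V x. F x v)"
    using inner x by (intro cINF_lower bdd_belowI[of _ 0]) auto
  also have "\<dots> \<le> F x v"
    using nonneg x v by (intro cINF_lower bdd_belowI[of _ 0]) auto
  finally show "(INF x\<in>X. INF v\<in>V x. F x v) \<le> F x v" .
qed

text \<open>In dimension 1 a nonzero \<open>x\<close> has no nonzero orthogonal vector, and the
  inner infima would range over the empty set.\<close>

lemma orthogonal_vectors_nonempty:
  assumes "CARD('n) \<ge> 2"
  shows "{v :: real ^ 'n. v \<noteq> 0 \<and> v \<bullet> x = 0} \<noteq> {}"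
  using orthogonal_to_vector_exists[of x] assms
  by (auto simp: orthogonal_def inner_commute)

lemma spd_nonneg: "spd A \<Longrightarrow> x \<bullet> (A *v x) \<ge> 0"
  by (cases "x = 0") (auto simp: spd_def less_imp_le)

text \<open>Since \<open>cos\<close> decreases on the interval from 0 to \<open>pi\<close>, a lower
  bound on the angle is an upper bound on its cosine.\<close>

lemma inner_le_cos_min_angle:
  fixes A M :: "real ^ 'n ^ 'n"
  assumes dim: "CARD('n) \<ge> 2" and A: "spd A"
    and x: "x \<in> Rq_sublevel A M \<rho>" and v: "v \<noteq> 0" "v \<bullet> x = 0"
  shows "\<bar>v \<bullet> (A *v x)\<bar> \<le> cos (min_angle A M \<rho>) * (mnorm A v * mnorm A x)"
    and "cos (min_angle A M \<rho>) \<ge> 0"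
proof -
  define q where "q y w = \<bar>w \<bullet> (A *v y)\<bar> / (mnorm A w * mnorm A y)" for y w
  have pos: "mnorm A w > 0" if "w \<noteq> 0" for w
    using A that by (simp add: mnorm_def spd_def)
  \<comment> \<open>By Cauchy-Schwarz; for a zero vector the division yields 0.\<close>
  have q: "0 \<le> q y w \<and> q y w \<le> 1" for y w
    using spd_Cauchy_Schwarz[OF A, of w y] spd_nonneg[OF A]
    by (auto simp: q_def mnorm_def divide_le_eq_1 less_le)
  then have "0 \<le> arccos (q y w)" for y w
    using arccos_lbound[of "q y w"] by (smt (verit))
  then have "0 \<le> min_angle A M \<rho>" "min_angle A M \<rho> \<le> arccos (q x v)"
    unfolding min_angle_def q_def
    using nested_INF_bounds[where F = "\<lambda>y w. arccos (\<bar>w \<bullet> (A *v y)\<bar> / (mnorm A w * mnorm A y))"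
        and V = "\<lambda>y. {w. w \<noteq> 0 \<and> w \<bullet> y = 0}", OF x _ orthogonal_vectors_nonempty[OF dim], of v] v
    by (simp_all add: q_def)
  moreover have "arccos (q x v) \<le> pi" using q[of x v] by (intro arccos_ubound) auto
  ultimately have "cos (arccos (q x v)) \<le> cos (min_angle A M \<rho>)"
    by (intro cos_monotone_0_pi_le) auto
  then have *: "q x v \<le> cos (min_angle A M \<rho>)" using q[of x v] by (simp add: cos_arccos)
  then show "cos (min_angle A M \<rho>) \<ge> 0" using q[of x v] by linarith
  have "x \<noteq> 0" using x by (simp add: Rq_sublevel_def)
  with * pos v show "\<bar>v \<bullet> (A *v x)\<bar> \<le> cos (min_angle A M \<rho>) * (mnorm A v * mnorm A x)"
    by (simp add: q_def pos_divide_le_eq)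
qed

lemma min_orth_Rq_le:
  fixes A M :: "real ^ 'n ^ 'n"
  assumes dim: "CARD('n) \<ge> 2" and A: "spd A" and M: "spd M"
    and x: "x \<in> Rq_sublevel A M \<rho>" and v: "v \<noteq> 0" "v \<bullet> x = 0"
  shows "min_orth_Rq A M \<rho> \<le> Rq A M v"
proof -
  have "0 \<le> Rq A M w" for w using spd_nonneg[OF A] spd_nonneg[OF M] by (simp add: Rq_def)
  with nested_INF_bounds(2)[where F = "\<lambda>y. Rq A M" and V = "\<lambda>y. {w. w \<noteq> 0 \<and> w \<bullet> y = 0}",
      OF x _ orthogonal_vectors_nonempty[OF dim], of v] v
  show ?thesis by (simp add: min_orth_Rq_def)
qed

text \<open>The extreme eigenvalues of \<open>A\<close> bound the quotient on both sides, so
  supremum and infimum behave; the smallest one, being positive, also bounds the infimum away from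
  0.\<close>

lemma
  assumes A: "spd A" and x: "x \<in> Rq_sublevel A M \<rho>" and norm: "norm x = 1"
  shows sigma_max_ge: "x \<bullet> (A *v x) \<le> sigma_max A M \<rho>"
    and sigma_min_le: "sigma_min A M \<rho> \<le> x \<bullet> (A *v x)"
    and sigma_min_pos: "sigma_min A M \<rho> > 0"
proof -
  have "transpose A = A" using A by (simp add: spd_def)
  note bounds = eigenvalues_bounds_symmetric[OF this]
  have le: "Min (eigenvalues A) \<le> (y \<bullet> (A *v y)) / (y \<bullet> y)"
    "(y \<bullet> (A *v y)) / (y \<bullet> y) \<le> Max (eigenvalues A)" if "y \<in> Rq_sublevel A M \<rho>" for y
    using bounds[of y] that by (simp_all add: Rq_sublevel_def dot_square_norm field_simps)
  have xx: "x \<bullet> x = 1" using norm by (simp add: dot_square_norm)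
  have "(x \<bullet> (A *v x)) / (x \<bullet> x) \<le> sigma_max A M \<rho>"
    unfolding sigma_max_def using le(2) x by (intro cSUP_upper bdd_aboveI) auto
  then show "x \<bullet> (A *v x) \<le> sigma_max A M \<rho>" by (simp add: xx)
  have "sigma_min A M \<rho> \<le> (x \<bullet> (A *v x)) / (x \<bullet> x)"
    unfolding sigma_min_def using le(1) x by (intro cINF_lower bdd_belowI) auto
  then show "sigma_min A M \<rho> \<le> x \<bullet> (A *v x)" by (simp add: xx)
  have "Min (eigenvalues A) \<le> sigma_min A M \<rho>"
    unfolding sigma_min_def using le(1) x by (intro cINF_greatest) auto
  then show "sigma_min A M \<rho> > 0" using spd_Min_eigenvalues_pos[OF A] by linarith
qed

section \<open>Bounds on the Hessian\<close>

text \<open>The residual \<open>A x - r M x\<close> equals \<open>A (x - r w)\<close> for \<open>w\<close> with \<open>A w = M x\<close>, so the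
  estimate is the Cauchy--Schwarz inequality of \<open>A\<close> together with \<open>M A\<^sup>-\<^sup>1 M \<le> M / l\<close>.\<close>

lemma residual_bound:
  fixes A M :: "real ^ 'n ^ 'n"
  assumes A: "spd A" and M: "spd M" and x: "x \<noteq> 0" and l: "l > 0"
    and le: "\<And>y. l * (y \<bullet> (M *v y)) \<le> y \<bullet> (A *v y)"
  shows "(v \<bullet> (A *v x - Rq A M x *\<^sub>R (M *v x)))\<^sup>2
    \<le> (v \<bullet> (A *v v)) * (x \<bullet> (A *v x)) * ((Rq A M x - l) / l)"
proof -
  define r where "r = Rq A M x"
  define a where "a = x \<bullet> (A *v x)"
  define m where "m = x \<bullet> (M *v x)"
  have pos: "a > 0" "m > 0" using A M x by (simp_all add: a_def m_def spd_def)
  then have rm: "r * m = a" and r: "r > 0" by (simp_all add: r_def Rq_def a_def m_def)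
  obtain N where "A ** N = mat 1" using spd_invertible[OF A] by (auto simp: invertible_def)
  then obtain w where w: "A *v w = M *v x"
    by (metis matrix_vector_mul_assoc matrix_vector_mul_lid)
  \<comment> \<open>This is the form of \<open>M A\<^sup>-\<^sup>1 M\<close> at
    \<open>x\<close>.\<close>
  define k where "k = w \<bullet> (A *v w)"
  have k: "k \<ge> 0" by (simp add: k_def spd_nonneg[OF A])
  have sq: "(mnorm C y)\<^sup>2 = y \<bullet> (C *v y)" if "spd C" for C :: "real ^ 'n ^ 'n" and y
    using spd_nonneg[OF that] by (simp add: mnorm_def)
  have CS: "(y \<bullet> (C *v z))\<^sup>2 \<le> (y \<bullet> (C *v y)) * (z \<bullet> (C *v z))"
    if "spd C" for C :: "real ^ 'n ^ 'n" and y z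
    using power_mono[OF spd_Cauchy_Schwarz[OF that], of y z 2] by (simp add: power_mult_distrib sq[OF that])
  \<comment> \<open>Since \<open>k\<close> is also \<open>w \<bullet> (M *v x)\<close>,
    Cauchy-Schwarz for \<open>M\<close> followed by \<open>le\<close> at \<open>w\<close> bounds
    \<open>k\<close> in terms of itself; cancelling one factor \<open>k\<close> gives
    \<open>km\<close>.\<close>
  have "k\<^sup>2 \<le> (w \<bullet> (M *v w)) * m"
    using CS[OF M, of w x] by (simp add: k_def w m_def)
  also have "\<dots> \<le> k / l * m"
    using le[of w] l pos by (intro mult_right_mono) (auto simp: k_def field_simps)
  finally have "k * k \<le> k * (m / l)" by (simp add: power2_eq_square)
  then have km: "k \<le> m / l"
    using k pos l by (metis divide_nonneg_pos less_imp_le mult_le_cancel_left_pos order_le_less)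
  have xw: "x \<bullet> (A *v w) = m" "w \<bullet> (A *v x) = m"
    using A w by (auto simp: m_def spd_def inner_symmetric_matrix inner_commute)
  have "(x - r *\<^sub>R w) \<bullet> (A *v (x - r *\<^sub>R w)) = a - 2 * r * m + r\<^sup>2 * k"
    by (simp add: matrix_vector_mult_diff_distrib inner_diff_left inner_diff_right xw
        a_def[symmetric] k_def[symmetric] power2_eq_square algebra_simps matrix_vector_mult_scaleR)
  also have "\<dots> \<le> a - 2 * r * m + r\<^sup>2 * (m / l)"
    using km by (intro add_left_mono mult_left_mono) auto
  also have "\<dots> = a * ((r - l) / l)"
    using l by (simp add: field_simps power2_eq_square flip: rm)
  finally have *: "(x - r *\<^sub>R w) \<bullet> (A *v (x - r *\<^sub>R w)) \<le> a * ((r - l) / l)" .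
  have "(v \<bullet> (A *v x - r *\<^sub>R (M *v x)))\<^sup>2 = (v \<bullet> (A *v (x - r *\<^sub>R w)))\<^sup>2"
    by (simp add: matrix_vector_mult_diff_distrib w matrix_vector_mult_scaleR)
  also have "\<dots> \<le> (v \<bullet> (A *v v)) * ((x - r *\<^sub>R w) \<bullet> (A *v (x - r *\<^sub>R w)))"
    by (rule CS[OF A])
  also have "\<dots> \<le> (v \<bullet> (A *v v)) * (a * ((r - l) / l))"
    using * spd_nonneg[OF A] by (rule mult_left_mono)
  finally show ?thesis by (simp add: a_def r_def mult.assoc)
qed

text \<open>Writing \<open>r * h = p - g\<close> splits the product into \<open>g\<^sup>2\<close>
  and \<open>g * p\<close>: the first yields the summand \<open>(\<rho> - l) / l\<close>, the second
  the square root times the cosine.\<close>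

lemma hess_remainder_bound:
  fixes A M :: "real ^ 'n ^ 'n"
  assumes dim: "CARD('n) \<ge> 2" and A: "spd A" and M: "spd M" and l: "l > 0"
    and le: "\<And>y. l * (y \<bullet> (M *v y)) \<le> y \<bullet> (A *v y)"
    and x: "x \<in> Rq_sublevel A M \<rho>" "norm x = 1" and v: "v \<noteq> 0" "v \<bullet> x = 0"
  shows "\<bar>8 / (x \<bullet> (M *v x))\<^sup>2 * (v \<bullet> (A *v x - Rq A M x *\<^sub>R (M *v x))) * (v \<bullet> (M *v x))\<bar>
    \<le> 8 * Max (eigenvalues A) * \<rho> / sigma_min A M \<rho>
        * ((\<rho> - l) / l + sqrt ((\<rho> - l) / l) * cos (min_angle A M \<rho>)) * (norm v)\<^sup>2"
proof -
  define r where "r = Rq A M x"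
  define a where "a = x \<bullet> (A *v x)"
  define m where "m = x \<bullet> (M *v x)"
  define b where "b = v \<bullet> (A *v v)"
  define g where "g = v \<bullet> (A *v x - r *\<^sub>R (M *v x))"
  define h where "h = v \<bullet> (M *v x)"
  define p where "p = v \<bullet> (A *v x)"
  define \<delta> where "\<delta> = (\<rho> - l) / l"
  define K where "K = cos (min_angle A M \<rho>)"
  define s where "s = sigma_min A M \<rho>"
  have x0: "x \<noteq> 0" and r\<rho>: "r \<le> \<rho>" using x by (auto simp: Rq_sublevel_def r_def)
  have pos: "a > 0" "m > 0" "b > 0" using A M x0 v by (simp_all add: a_def m_def b_def spd_def)
  have rm: "m * r = a" and r: "r > 0" using pos by (simp_all add: r_def Rq_def a_def m_def)
  have "l \<le> r" using le[of x] pos by (simp add: r_def Rq_def a_def m_def field_simps)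
  then have \<delta>: "\<delta> \<ge> 0" using r\<rho> l by (simp add: \<delta>_def)
  have s: "0 < s" "s \<le> a"
    using sigma_min_pos[OF A x] sigma_min_le[OF A x] by (simp_all add: s_def a_def)
  have "g\<^sup>2 \<le> b * a * ((r - l) / l)"
    using residual_bound[OF A M x0 l le] by (simp add: g_def r_def a_def b_def)
  also have "\<dots> \<le> b * a * \<delta>"
    using pos l r\<rho> by (simp add: \<delta>_def divide_right_mono)
  finally have g2: "g\<^sup>2 \<le> b * a * \<delta>" .
  then have g: "\<bar>g\<bar> \<le> sqrt (b * a) * sqrt \<delta>"
    by (metis real_sqrt_abs real_sqrt_le_iff real_sqrt_mult)
  have p: "\<bar>p\<bar> \<le> K * sqrt (b * a)" and K: "K \<ge> 0"
    using inner_le_cos_min_angle[OF dim A x(1) v]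
    by (simp_all add: p_def K_def mnorm_def a_def b_def real_sqrt_mult)
  have "\<bar>g\<bar> * \<bar>p\<bar> \<le> (sqrt (b * a) * sqrt \<delta>) * (K * sqrt (b * a))"
    using g p by (intro mult_mono) auto
  also have "\<dots> = (sqrt (b * a) * sqrt (b * a)) * (sqrt \<delta> * K)" by (simp only: mult_ac)
  also have "sqrt (b * a) * sqrt (b * a) = b * a" using pos by simp
  finally have gp: "\<bar>g\<bar> * \<bar>p\<bar> \<le> b * a * (sqrt \<delta> * K)" .
  have h: "r * h = p - g" by (simp add: g_def h_def p_def inner_diff_right)
  \<comment> \<open>One factor \<open>r\<close> is inserted in numerator and denominator, so that
    \<open>h\<close> becomes \<open>r * h\<close> and one \<open>m\<close> becomes
    \<open>a\<close>.\<close>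
  have "8 / m\<^sup>2 * g * h = 8 / (m * (m * r)) * (g * (r * h))"
    using r by (simp add: power2_eq_square)
  also have "m * r = a" by (rule rm)
  finally have "8 / m\<^sup>2 * g * h = 8 / (m * a) * (g * (r * h))" .
  then have "\<bar>8 / m\<^sup>2 * g * h\<bar> = 8 / (m * a) * \<bar>g * (p - g)\<bar>"
    using pos by (simp add: h abs_mult)
  also have "\<bar>g * (p - g)\<bar> \<le> g\<^sup>2 + \<bar>g\<bar> * \<bar>p\<bar>"
    using mult_left_mono[OF abs_triangle_ineq4[of p g], of "\<bar>g\<bar>"]
    by (simp add: abs_mult distrib_left power2_eq_square)
  also have "\<dots> \<le> b * a * \<delta> + b * a * (sqrt \<delta> * K)"
    using g2 gp by linarith
  finally have "\<bar>8 / m\<^sup>2 * g * h\<bar> \<le> 8 / (m * a) * (b * a * \<delta> + b * a * (sqrt \<delta> * K))"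
    using pos by (simp add: divide_right_mono)
  also have "\<dots> = 8 / m * b * (\<delta> + sqrt \<delta> * K)"
    using pos by (simp add: field_simps)
  \<comment> \<open>The remaining \<open>1 / m\<close> equals \<open>r / a\<close>, which is at most
    \<open>\<rho> / s\<close>.\<close>
  also have "\<dots> \<le> 8 * (\<rho> / s) * (Max (eigenvalues A) * (norm v)\<^sup>2) * (\<delta> + sqrt \<delta> * K)"
  proof (intro mult_right_mono mult_mono)
    have "1 / m = r / a" using r by (simp flip: rm)
    also have "\<dots> \<le> \<rho> / s" using r r\<rho> s by (intro frac_le) auto
    finally show "8 / m \<le> 8 * (\<rho> / s)" by simp
    show "b \<le> Max (eigenvalues A) * (norm v)\<^sup>2"
      using eigenvalues_bounds_symmetric(2)[of A v] A by (simp add: b_def spd_def)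
    show "0 \<le> 8 * (\<rho> / s)" using r r\<rho> s by simp
  qed (use pos K \<delta> in auto)
  also have "\<dots> = 8 * Max (eigenvalues A) * \<rho> / s * (\<delta> + sqrt \<delta> * K) * (norm v)\<^sup>2"
    by (simp only: mult_ac times_divide_eq_left times_divide_eq_right)
  finally show ?thesis
    unfolding m_def g_def r_def h_def s_def \<delta>_def K_def .
qed

text \<open>In the main term, \<open>2 / m = 2 * r / a\<close> is squeezed using the bounds on
  \<open>r\<close> and \<open>a\<close>, while \<open>b - r * d\<close> is compared with
  \<open>b\<close> through the Rayleigh quotient \<open>b / d\<close> of \<open>v\<close>: at least
  \<open>min_orth_Rq\<close> by orthogonality to \<open>x\<close>, at most \<open>L\<close> in
  general.\<close>

lemma riemannian_hess_Rq_bounds: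
  fixes A M :: "real ^ 'n ^ 'n"
  assumes dim: "CARD('n) \<ge> 2" and A: "spd A" and M: "spd M" and l: "l > 0"
    and le: "\<And>y. l * (y \<bullet> (M *v y)) \<le> y \<bullet> (A *v y)" "\<And>y. y \<bullet> (A *v y) \<le> L * (y \<bullet> (M *v y))"
    and x: "x \<in> Rq_sublevel A M \<rho>" "norm x = 1" and v: "v \<in> tangent_space x"
    and orth: "min_orth_Rq A M \<rho> > \<rho>"
  defines "C \<equiv> 8 * Max (eigenvalues A) * \<rho> / sigma_min A M \<rho>
        * ((\<rho> - l) / l + sqrt ((\<rho> - l) / l) * cos (min_angle A M \<rho>))"
  shows "(2 * Min (eigenvalues A) * l / sigma_max A M \<rho> * (1 - \<rho> / min_orth_Rq A M \<rho>) - C) * (norm v)\<^sup>2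
      \<le> v \<bullet> riemannian_hess (Rq A M) x v"
    and "v \<bullet> riemannian_hess (Rq A M) x v
      \<le> (2 * Max (eigenvalues A) * \<rho> / sigma_min A M \<rho> * (1 - l / L) + C) * (norm v)\<^sup>2"
proof -
  define r where "r = Rq A M x"
  define a where "a = x \<bullet> (A *v x)"
  define m where "m = x \<bullet> (M *v x)"
  define b where "b = v \<bullet> (A *v v)"
  define d where "d = v \<bullet> (M *v v)"
  define s where "s = sigma_min A M \<rho>"
  define S where "S = sigma_max A M \<rho>"
  define \<eta> where "\<eta> = min_orth_Rq A M \<rho>"
  define R where "R = 8 / m\<^sup>2 * (v \<bullet> (A *v x - r *\<^sub>R (M *v x))) * (v \<bullet> (M *v x))"
  have hess: "v \<bullet> riemannian_hess (Rq A M) x v = 2 / m * (b - r * d) - R"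
    using inner_riemannian_hess_Rq[OF _ M x(2) v] A
    by (simp add: r_def m_def b_def d_def R_def spd_def)
  have "2 * Min (eigenvalues A) * l / S * (1 - \<rho> / \<eta>) * (norm v)\<^sup>2 - C * (norm v)\<^sup>2 \<le> 2 / m * (b - r * d) - R
    \<and> 2 / m * (b - r * d) - R \<le> 2 * Max (eigenvalues A) * \<rho> / s * (1 - l / L) * (norm v)\<^sup>2 + C * (norm v)\<^sup>2"
  \<comment> \<open>The Rayleigh quotient of \<open>v\<close> and its angle with \<open>x\<close>
    are controlled only for nonzero \<open>v\<close>; for \<open>v = 0\<close> all terms
    vanish.\<close>
  proof (cases "v = 0")
    case True
    then show ?thesis by (simp add: b_def d_def R_def)
  next
    case False
    have vx: "v \<bullet> x = 0" using v by (simp add: tangent_space_def)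
    have x0: "x \<noteq> 0" and r\<rho>: "r \<le> \<rho>" using x by (auto simp: Rq_sublevel_def r_def)
    have pos: "a > 0" "m > 0" "b > 0" "d > 0"
      using A M x0 False by (simp_all add: a_def m_def b_def d_def spd_def)
    have rm: "m * r = a" and r: "r > 0" using pos by (simp_all add: r_def Rq_def a_def m_def)
    have lr: "l \<le> r" using le(1)[of x] pos by (simp add: r_def Rq_def a_def m_def field_simps)
    have "l * m \<le> L * m" using le[of x] by (simp add: m_def)
    then have L: "l \<le> L" using pos by simp
    have s: "0 < s" "s \<le> a" "a \<le> S"
      using sigma_min_pos[OF A x] sigma_min_le[OF A x] sigma_max_ge[OF A x]
      by (simp_all add: s_def a_def S_def)
    have R: "\<bar>R\<bar> \<le> C * (norm v)\<^sup>2"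
      using hess_remainder_bound[OF dim A M l le(1) x False vx] unfolding R_def C_def r_def m_def .
    have mr: "1 / m = r / a" using r by (simp flip: rm)
    have eig: "Min (eigenvalues A) * (norm v)\<^sup>2 \<le> b" "b \<le> Max (eigenvalues A) * (norm v)\<^sup>2"
      using eigenvalues_bounds_symmetric[of A v] A by (simp_all add: b_def spd_def)
    have \<eta>: "\<eta> \<le> b / d" "\<rho> < \<eta>"
      using min_orth_Rq_le[OF dim A M x(1) False vx] orth by (simp_all add: \<eta>_def Rq_def b_def d_def)
    have "r * d \<le> \<rho> * (b / \<eta>)"
      using \<eta> r r\<rho> pos by (intro mult_mono) (auto simp: field_simps)
    then have lo: "b * (1 - \<rho> / \<eta>) \<le> b - r * d" by (simp add: right_diff_distrib mult.commute)
    have "l * (b / L) \<le> r * d"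
      using le(2)[of v] lr l L pos by (intro mult_mono) (auto simp: field_simps b_def d_def)
    then have up: "b - r * d \<le> b * (1 - l / L)" by (simp add: right_diff_distrib mult.commute)
    \<comment> \<open>The factor \<open>1 - \<rho> / \<eta>\<close> is nonnegative because
      \<open>\<eta>\<close> exceeds \<open>\<rho>\<close>, so both other factors can be estimated
      independently.\<close>
    have "2 * (l / S) * (Min (eigenvalues A) * (norm v)\<^sup>2) * (1 - \<rho> / \<eta>) \<le> 2 / m * b * (1 - \<rho> / \<eta>)"
    proof (intro mult_right_mono mult_mono)
      have "l / S \<le> r / a" using lr l s pos by (intro frac_le) auto
      then show "2 * (l / S) \<le> 2 / m" by (simp flip: mr)
    qed (use eig \<eta> r r\<rho> pos spd_Min_eigenvalues_pos[OF A] in auto)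
    also have "\<dots> = 2 / m * (b * (1 - \<rho> / \<eta>))" by simp
    also have "\<dots> \<le> 2 / m * (b - r * d)"
      using lo pos by (intro mult_left_mono) auto
    finally have lower: "2 * Min (eigenvalues A) * l / S * (1 - \<rho> / \<eta>) * (norm v)\<^sup>2 \<le> 2 / m * (b - r * d)"
      by (simp only: mult_ac times_divide_eq_left times_divide_eq_right)
    have "2 / m * (b - r * d) \<le> 2 / m * (b * (1 - l / L))"
      using up pos by (intro mult_left_mono) auto
    also have "\<dots> = 2 / m * b * (1 - l / L)" by simp
    also have "\<dots> \<le> 2 * (\<rho> / s) * (Max (eigenvalues A) * (norm v)\<^sup>2) * (1 - l / L)"
    proof (intro mult_right_mono mult_mono)
      have "r / a \<le> \<rho> / s" using r r\<rho> s by (intro frac_le) auto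
      then show "2 / m \<le> 2 * (\<rho> / s)" by (simp flip: mr)
    qed (use eig L l r r\<rho> s pos in auto)
    finally have upper: "2 / m * (b - r * d) \<le> 2 * Max (eigenvalues A) * \<rho> / s * (1 - l / L) * (norm v)\<^sup>2"
      by (simp only: mult_ac times_divide_eq_left times_divide_eq_right)
    show ?thesis using lower upper R by linarith
  qed
  then show "(2 * Min (eigenvalues A) * l / sigma_max A M \<rho> * (1 - \<rho> / min_orth_Rq A M \<rho>) - C) * (norm v)\<^sup>2
      \<le> v \<bullet> riemannian_hess (Rq A M) x v"
    and "v \<bullet> riemannian_hess (Rq A M) x v
      \<le> (2 * Max (eigenvalues A) * \<rho> / sigma_min A M \<rho> * (1 - l / L) + C) * (norm v)\<^sup>2"
    unfolding hess by (simp_all add: S_def s_def \<eta>_def left_diff_distrib distrib_right)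
qed

theorem theorem16:
  fixes A M B :: "real ^ 'n ^ 'n"
    and lam :: "nat \<Rightarrow> real" and u1 :: "real ^ 'n" and \<rho> :: real
  defines "A_B \<equiv> precond B A"
    and "M_B \<equiv> precond B M"
    and "u_B \<equiv> (1 / mnorm B u1) *\<^sub>R (spd_sqrt B *v u1)"
  defines "X_B \<equiv> {x \<in> sphere 0 1. x \<bullet> u_B > 0 \<and> Rq A_B M_B x \<le> \<rho>}"
    and "\<theta> \<equiv> min_angle A_B M_B \<rho>"
    and "\<rho>' \<equiv> min_orth_Rq A_B M_B \<rho>"
    and "\<sigma>max \<equiv> sigma_max A_B M_B \<rho>"
    and "\<sigma>min \<equiv> sigma_min A_B M_B \<rho>"
    and "\<nu>min \<equiv> Min (eigenvalues A_B)"
    and "\<nu>max \<equiv> Max (eigenvalues A_B)"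
  defines "C_X \<equiv> 8 * \<nu>max * \<rho> / \<sigma>min *
             ((\<rho> - lam 1) / lam 1 + sqrt ((\<rho> - lam 1) / lam 1) * cos \<theta>)"
  defines "\<mu>_B \<equiv> 2 * \<nu>min * lam 1 / \<sigma>max * (1 - \<rho> / \<rho>') - C_X"
    and "L_B \<equiv> 2 * \<nu>max * \<rho> / \<sigma>min * (1 - lam 1 / lam CARD('n)) + C_X"
  assumes dim: "CARD('n) \<ge> 2"
    and spd: "spd A" "spd M" "spd B"
    and eigs: "pencil_eigenvalues A M lam"
    and gap: "0 < lam 1" "lam 1 < lam 2"
    and eigvec: "u1 \<noteq> 0" "A *v u1 = lam 1 *\<^sub>R (M *v u1)"
    and rho: "lam 1 \<le> \<rho>" "\<rho> < (lam 1 + lam 2) / 2"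
    and orth: "\<rho>' > \<rho>"
  shows "\<forall>x \<in> X_B. \<forall>v \<in> tangent_space x.
           \<mu>_B * (norm v)\<^sup>2 \<le> v \<bullet> riemannian_hess (Rq A_B M_B) x v \<and>
           v \<bullet> riemannian_hess (Rq A_B M_B) x v \<le> L_B * (norm v)\<^sup>2"
proof (intro ballI)
  fix x v assume x: "x \<in> X_B" and v: "v \<in> tangent_space x"
  have A: "spd A_B" and M: "spd M_B"
    using spd by (simp_all add: A_B_def M_B_def spd_precond)
  have "transpose A = A" using spd by (simp add: spd_def)
  note bounds = pencil_eigenvalues_bounds[OF eigs this spd(2)]
  \<comment> \<open>The congruence transports the bounds by \<open>lam\<close> from the original
    pencil to the preconditioned one, with the same constants.\<close>
  have le: "lam 1 * (y \<bullet> (M_B *v y)) \<le> y \<bullet> (A_B *v y)"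
    "y \<bullet> (A_B *v y) \<le> lam CARD('n) * (y \<bullet> (M_B *v y))" for y
    unfolding A_B_def M_B_def inner_precond[OF spd(3)] by (rule bounds)+
  have x': "x \<in> Rq_sublevel A_B M_B \<rho>" "norm x = 1"
    using x by (auto simp: X_B_def Rq_sublevel_def)
  show "\<mu>_B * (norm v)\<^sup>2 \<le> v \<bullet> riemannian_hess (Rq A_B M_B) x v \<and>
      v \<bullet> riemannian_hess (Rq A_B M_B) x v \<le> L_B * (norm v)\<^sup>2"
    using riemannian_hess_Rq_bounds[OF dim A M gap(1) le x' v] orth
    unfolding \<mu>_B_def L_B_def C_X_def \<theta>_def \<rho>'_def \<sigma>max_def \<sigma>min_def \<nu>min_def \<nu>max_def
    by blast
qed

end
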